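(* Let $\mathscr O_2$ be a finite local principal ideal ring of length two, with unique maximal ideal $\mathfrak m$ and residue field $k\cong\mathbb F_q$ of odd characteristic. Let $F(t)\in\mathscr O_2[t]$ be a monic fundamental irreducible polynomial, $r\ge1$ an integer, and let $A\in\mathrm{GL}_n(\mathscr O_2)$ be a compatible cyclic matrix with $\chi_{\mathscr O_2,A}(t)=F(t)^r$, such that the reduction $\overline A\in\mathrm{GL}_n(k)$ is a cyclic matrix with $\chi_{k,\overline A}(t)=\overline F(t)^r$. Then $A$ is conjugate by an element of $\mathrm{GL}_n(\mathscr O_2)$ to the $r\times r$ block matrix $$J_{\mathscr O_2,F}(r)=\begin{pmatrix} C_F & & & \\ I & C_F & & \\ & \ddots & \ddots & \\ & & I & C_F\end{pmatrix},$$ with diagonal blocks $C_F$, identity blocks $I$ of size $\deg F\times\deg F$ directly below the diagonal, and zero blocks elsewhere, where $C_F$ is the companion matrix of $F$.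
   Context: An overline denotes reduction modulo $\mathfrak m$. $\chi_{R,X}(t)=\det(tI-X)$ is the characteristic polynomial of a matrix $X$ over a ring $R$. A polynomial $F\in\mathscr O_2[t]$ is fundamental irreducible if $\overline F$ is irreducible in $k[t]$. A matrix $A\in\mathrm{GL}_n(\mathscr O_2)$ is cyclic if the characteristic and minimal polynomials of $\overline A$ over $k$ coincide; it is compatible cyclic if moreover $\chi_{\mathscr O_2,A}(t)$ is a product $\prod_i F_i(t)^{r_i}$ with $F_i$ monic fundamental irreducible and pairwise coprime ($\langle F_i,F_j\rangle=\mathscr O_2[t]$ for $i\neq j$). For a monic $F(t)=t^d+\sum_{i=0}^{d-1}c_it^i$, the companion matrix $C_F$ is the $d\times d$ matrix with $1$'s on the subdiagonal, last column $(-c_0,-c_1,\dots,-c_{d-1})^{T}$, and zeros elsewhere. *)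

theory Defs
  imports
    "Jordan_Normal_Form.Char_Poly"
    "HOL-Algebra.Algebraic_Closure_Type"
    "HOL-Library.Extended_Nat"
begin

text \<open>
  Rings are types of class \<^class>\<open>comm_ring_1\<close>, so that the matrices of
  \<^theory>\<open>Jordan_Normal_Form.Matrix\<close> and the type of univariate polynomials are available.
  Statements about ideals go through \<^const>\<open>ring_of_type_algebra\<close>, the same ring as a record.
\<close>

definition ring_length :: "('a, 'b) ring_scheme \<Rightarrow> enat" where
  "ring_length R =
     Sup {enat l | l. \<exists>I :: nat \<Rightarrow> 'a set.
            (\<forall>i\<le>l. ideal (I i) R) \<and> (\<forall>i<l. I i \<subset> I (Suc i))}"

definition local_pir_of_length_two :: "('a, 'b) ring_scheme \<Rightarrow> bool" where
  "local_pir_of_length_two R \<longleftrightarrow>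
     cring R \<and> (\<exists>!M. maximalideal M R) \<and>
     (\<forall>I. ideal I R \<longrightarrow> principalideal I R) \<and> ring_length R = 2"

text \<open>
  The residue field is any field isomorphic to the quotient by \<open>M\<close>: a field type together with a
  surjective homomorphism \<open>\<rho>\<close> with kernel \<open>M\<close>. Reduction modulo \<open>M\<close> is \<open>\<rho>\<close>, applied to the
  coefficients of a polynomial and to the entries of a matrix.
\<close>

definition residue_map :: "'a::comm_ring_1 set \<Rightarrow> ('a \<Rightarrow> 'k::field) \<Rightarrow> bool" where
  "residue_map M \<rho> \<longleftrightarrow> comm_ring_hom \<rho> \<and> surj \<rho> \<and> {a. \<rho> a = 0} = M"

definition fundamental_irreducible ::
    "('a::comm_ring_1 \<Rightarrow> 'k::field) \<Rightarrow> 'a poly \<Rightarrow> bool" where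
  "fundamental_irreducible \<rho> F \<longleftrightarrow> Factorial_Ring.irreducible (map_poly \<rho> F)"

definition GL :: "nat \<Rightarrow> 'a::comm_ring_1 mat set" where
  "GL n = {A \<in> carrier_mat n n. invertible_mat A}"

definition poly_mat_eval :: "'a::comm_ring_1 poly \<Rightarrow> 'a mat \<Rightarrow> 'a mat" where
  "poly_mat_eval p A =
     mat (dim_row A) (dim_row A)
       (\<lambda>(i, j). \<Sum>l\<le>Polynomial.degree p. Polynomial.coeff p l * (A ^\<^sub>m l) $$ (i, j))"

definition is_minimal_polynomial :: "'k::field mat \<Rightarrow> 'k poly \<Rightarrow> bool" where
  "is_minimal_polynomial A p \<longleftrightarrow>
     monic p \<and>
     poly_mat_eval p A = 0\<^sub>m (dim_row A) (dim_row A) \<and>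
     (\<forall>q. poly_mat_eval q A = 0\<^sub>m (dim_row A) (dim_row A) \<longrightarrow> p dvd q)"

definition cyclic_mat :: "('a::comm_ring_1 \<Rightarrow> 'k::field) \<Rightarrow> 'a mat \<Rightarrow> bool" where
  "cyclic_mat \<rho> A \<longleftrightarrow> is_minimal_polynomial (map_mat \<rho> A) (char_poly (map_mat \<rho> A))"

definition compatible_cyclic :: "('a::comm_ring_1 \<Rightarrow> 'k::field) \<Rightarrow> 'a mat \<Rightarrow> bool" where
  "compatible_cyclic \<rho> A \<longleftrightarrow>
     cyclic_mat \<rho> A \<and>
     (\<exists>(m::nat) (G :: nat \<Rightarrow> 'a poly) (e :: nat \<Rightarrow> nat).
        (\<forall>i<m. monic (G i) \<and> fundamental_irreducible \<rho> (G i) \<and> e i \<ge> 1) \<and>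
        (\<forall>i<m. \<forall>j<m. i \<noteq> j \<longrightarrow>
           genideal (ring_of_type_algebra :: 'a poly ring) {G i, G j} = UNIV) \<and>
        char_poly A = (\<Prod>i<m. G i ^ e i))"

definition companion_mat :: "'a::comm_ring_1 poly \<Rightarrow> 'a mat" where
  "companion_mat F =
     (let d = Polynomial.degree F in
      mat d d (\<lambda>(i, j).
        if j = d - 1 then - Polynomial.coeff F i
        else if i = j + 1 then 1 else 0))"

text \<open>
  Entry \<open>(i, j)\<close> lies in block \<open>(i div d, j div d)\<close>, at position \<open>(i mod d, j mod d)\<close> inside it.
\<close>

definition jordan_companion_mat :: "'a::comm_ring_1 poly \<Rightarrow> nat \<Rightarrow> 'a mat" where
  "jordan_companion_mat F r =
     (let d = Polynomial.degree F in
      mat (r * d) (r * d) (\<lambda>(i, j).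
        if i div d = j div d then companion_mat F $$ (i mod d, j mod d)
        else if i div d = j div d + 1 then (1\<^sub>m d) $$ (i mod d, j mod d)
        else 0))"

end

theory Submission
  imports Defs
begin

text \<open>
  A matrix \<open>B\<close> is conjugate to a companion matrix as soon as some vector \<open>v\<close> has a \<^emph>\<open>Krylov matrix\<close>
  \<open>[v, B v, \<dots>, B\<^bsup>n-1\<^esup> v]\<close> whose determinant is a unit: in the basis formed by its columns, \<open>B\<close> shifts each
  basis vector to the next, and the last column records the coefficients of the monic polynomial \<open>p\<close> of
  degree \<open>n\<close> with \<open>p(B) v = 0\<close>. So it is enough to conjugate both \<open>A\<close> and the generalised Jordan block
  \<open>J = J\<^sub>F(r)\<close> to the companion matrix of \<open>F\<^bsup>r\<^esup>\<close>.

  The ring is finite and local, so a determinant is a unit if its reduction is nonzero, and the search for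
  \<open>v\<close> takes place over the residue field \<open>k\<close>. Let \<open>f\<close> be the reduction of \<open>F\<close> and let \<open>B\<close> now be a matrix
  over \<open>k\<close>. If \<open>f\<^bsup>r\<^esup>(B) v = 0\<close> but \<open>f\<^bsup>r-1\<^esup>(B) v \<noteq> 0\<close>, then the annihilator of \<open>v\<close> in \<open>k[t]\<close> is generated by a
  divisor of \<open>f\<^bsup>r\<^esup>\<close> that does not divide \<open>f\<^bsup>r-1\<^esup>\<close>, hence by \<open>f\<^bsup>r\<^esup>\<close>, whose degree is \<open>n\<close>; no nontrivial
  combination of \<open>v, B v, \<dots>, B\<^bsup>n-1\<^esup> v\<close> vanishes (\<open>krylov_det_nonzero\<close>).

  For the reduction of \<open>A\<close>, the minimal polynomial is \<open>f\<^bsup>r\<^esup>\<close>, so \<open>f\<^bsup>r-1\<^esup>\<close> does not kill all unit vectors. The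
  polynomial \<open>p\<close> above is the characteristic polynomial of the companion matrix
  (\<open>char_poly_companion_mat\<close>), hence that of \<open>A\<close>, which is \<open>F\<^bsup>r\<^esup>\<close>.

  For \<open>J\<close>, identify the coordinate space with \<open>R[t, y] / (F(t), y\<^bsup>r\<^esup>)\<close>, the \<open>k\<close>-th block holding the
  coefficient of \<open>y\<^bsup>k\<^esup>\<close>. Then \<open>C\<^sub>F\<close> is multiplication by \<open>t\<close>, the identity blocks are multiplication by \<open>y\<close>,
  and \<open>J\<close> is multiplication by \<open>t + y\<close>. The first unit vector is \<open>1\<close>, so \<open>q(J)\<close> sends it to \<open>q(t + y)\<close>. As
  \<open>F(t + y) = F(t) + y (F'(t) + \<dots>)\<close>, the power \<open>F(t + y)\<^bsup>m\<^esup>\<close> is \<open>y\<^bsup>m\<^esup> (F'(t)\<^bsup>m\<^esup> + \<dots>)\<close> modulo \<open>F\<close>. This vanishes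
  for \<open>m = r\<close>; over \<open>k\<close> it does not for \<open>m = r - 1\<close>, because irreducible polynomials over a finite field are
  separable (\<open>pderiv_irreducible_nonzero\<close>) and so \<open>f\<close> does not divide \<open>f'\<close>.
\<close>

section \<open>Evaluating a polynomial at a matrix\<close>

lemma poly_mat_eval_carrier [simp]:
  "A \<in> carrier_mat n n \<Longrightarrow> poly_mat_eval p A \<in> carrier_mat n n"
  by (auto simp: poly_mat_eval_def)

lemma poly_mat_eval_dim [simp]:
  "dim_row (poly_mat_eval p A) = dim_row A" "dim_col (poly_mat_eval p A) = dim_row A"
  by (auto simp: poly_mat_eval_def)

text \<open>
  The defining sum runs up to the degree; any bound \<open>N\<close> beyond the support of \<open>p\<close> serves as well, which
  allows sums for different polynomials to be compared.
\<close>

lemma poly_mat_eval_index: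
  assumes "A \<in> carrier_mat n n" "i < n" "j < n" "\<And>l. l \<ge> N \<Longrightarrow> Polynomial.coeff p l = 0"
  shows "poly_mat_eval p A $$ (i, j) = (\<Sum>l<N. Polynomial.coeff p l * (A ^\<^sub>m l) $$ (i, j))"
proof -
  have "(\<Sum>l\<le>Polynomial.degree p. Polynomial.coeff p l * (A ^\<^sub>m l) $$ (i, j)) =
        (\<Sum>l<max N (Suc (Polynomial.degree p)). Polynomial.coeff p l * (A ^\<^sub>m l) $$ (i, j))"
    by (rule sum.mono_neutral_left) (auto intro!: le_degree)
  also have "\<dots> = (\<Sum>l<N. Polynomial.coeff p l * (A ^\<^sub>m l) $$ (i, j))"
    using assms(4) by (intro sum.mono_neutral_right) auto
  finally show ?thesis using assms(1-3) by (simp add: poly_mat_eval_def)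
qed

lemma pow_mat_Suc_left:
  assumes "A \<in> carrier_mat n n"
  shows "A ^\<^sub>m Suc l = A * A ^\<^sub>m l"
proof (induction l)
  case (Suc l)
  have "A ^\<^sub>m Suc (Suc l) = (A * A ^\<^sub>m l) * A" using Suc by simp
  also have "\<dots> = A * (A ^\<^sub>m l * A)"
    by (rule assoc_mult_mat[of _ n n _ n _ n]) (use assms in auto)
  finally show ?case by simp
qed (use assms in auto)

text \<open>
  Horner's rule. It turns every algebraic law of evaluation into an induction on the polynomial.
\<close>

lemma poly_mat_eval_pCons:
  assumes A: "A \<in> carrier_mat n n"
  shows "poly_mat_eval (pCons a p) A = a \<cdot>\<^sub>m 1\<^sub>m n + A * poly_mat_eval p A"
proof (rule eq_matI)
  let ?N = "Suc (Polynomial.degree p)"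
  fix i j assume "i < dim_row (a \<cdot>\<^sub>m 1\<^sub>m n + A * poly_mat_eval p A)"
    "j < dim_col (a \<cdot>\<^sub>m 1\<^sub>m n + A * poly_mat_eval p A)"
  with A have ij: "i < n" "j < n" by (auto simp: poly_mat_eval_def)
  have step: "(\<Sum>k<n. A $$ (i, k) * (A ^\<^sub>m l) $$ (k, j)) = (A ^\<^sub>m Suc l) $$ (i, j)" for l
    unfolding pow_mat_Suc_left[OF A]
    using A ij by (simp add: scalar_prod_def atLeast0LessThan)
  have "(A * poly_mat_eval p A) $$ (i, j) = (\<Sum>k<n. A $$ (i, k) * poly_mat_eval p A $$ (k, j))"
    using A ij poly_mat_eval_carrier[OF A, of p] by (simp add: scalar_prod_def atLeast0LessThan)
  also have "\<dots> = (\<Sum>k<n. \<Sum>l<?N. Polynomial.coeff p l * (A $$ (i, k) * (A ^\<^sub>m l) $$ (k, j)))"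
    using A ij
    by (intro sum.cong refl, subst poly_mat_eval_index[of _ n _ _ ?N])
       (auto simp: sum_distrib_left mult_ac coeff_eq_0 simp del: sum.lessThan_Suc)
  also have "\<dots> = (\<Sum>l<?N. Polynomial.coeff p l * (A ^\<^sub>m Suc l) $$ (i, j))"
    by (subst sum.swap) (simp only: sum_distrib_left[symmetric] step)
  finally have *: "(A * poly_mat_eval p A) $$ (i, j) = \<dots>" .
  have "poly_mat_eval (pCons a p) A $$ (i, j) =
        (\<Sum>l<Suc ?N. Polynomial.coeff (pCons a p) l * (A ^\<^sub>m l) $$ (i, j))"
    by (rule poly_mat_eval_index[OF A ij]) (auto simp: coeff_pCons intro: coeff_eq_0 split: nat.split)
  also have "\<dots> = a * (1\<^sub>m n $$ (i, j)) + (\<Sum>l<?N. Polynomial.coeff p l * (A ^\<^sub>m Suc l) $$ (i, j))"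
    using A by (subst sum.lessThan_Suc_shift) simp
  finally show "poly_mat_eval (pCons a p) A $$ (i, j) =
      (a \<cdot>\<^sub>m 1\<^sub>m n + A * poly_mat_eval p A) $$ (i, j)"
    using A ij poly_mat_eval_carrier[OF A, of p] by (simp add: *)
qed (use A poly_mat_eval_carrier[OF A] in auto)

lemma poly_mat_eval_pCons_vec:
  assumes A: "A \<in> carrier_mat n n" and v: "v \<in> carrier_vec n"
  shows "poly_mat_eval (pCons a p) A *\<^sub>v v = a \<cdot>\<^sub>v v + A *\<^sub>v (poly_mat_eval p A *\<^sub>v v)"
proof -
  have "(a \<cdot>\<^sub>m 1\<^sub>m n) *\<^sub>v v = a \<cdot>\<^sub>v v"
    using v by (intro eq_vecI) (auto simp: scalar_prod_def if_distrib[of "\<lambda>x. x * _"] if_distrib[of "\<lambda>x. _ * x"] sum.delta' cong: if_cong)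
  then show ?thesis
    using A v poly_mat_eval_carrier[OF A, of p]
    by (simp add: poly_mat_eval_pCons[OF A] add_mult_distrib_mat_vec[of _ n n] assoc_mult_mat_vec[of _ n n _ n])
qed

lemma poly_mat_eval_vec_carrier [simp]:
  "A \<in> carrier_mat n n \<Longrightarrow> v \<in> carrier_vec n \<Longrightarrow> poly_mat_eval p A *\<^sub>v v \<in> carrier_vec n"
  by (metis poly_mat_eval_carrier mult_mat_vec_carrier)

lemma vec_eq_zeroI:
  fixes x w :: "'a::comm_ring_1 vec"
  assumes "x \<in> carrier_vec n" "w \<in> carrier_vec n" "x + w = w"
  shows "x = 0\<^sub>v n"
proof (rule eq_vecI)
  fix i assume "i < dim_vec (0\<^sub>v n :: 'a vec)"
  then have i: "i < n" by simp
  have "(x + w) $ i = w $ i" using assms(3) by simp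
  then show "x $ i = 0\<^sub>v n $ i" using i assms(1,2) by simp
qed (use assms in simp)

lemma pow_mat_vec_carrier:
  "A \<in> carrier_mat n n \<Longrightarrow> v \<in> carrier_vec n \<Longrightarrow> A ^\<^sub>m l *\<^sub>v v \<in> carrier_vec n"
  by (rule mult_mat_vec_carrier[OF pow_carrier_mat])

lemma poly_mat_eval_0_vec [simp]:
  "A \<in> carrier_mat n n \<Longrightarrow> v \<in> carrier_vec n \<Longrightarrow> poly_mat_eval 0 A *\<^sub>v v = 0\<^sub>v n"
  by (intro eq_vecI) (auto simp: poly_mat_eval_def scalar_prod_def)

lemma poly_mat_eval_1_vec [simp]:
  assumes "A \<in> carrier_mat n n" "v \<in> carrier_vec n"
  shows "poly_mat_eval 1 A *\<^sub>v v = v"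
proof -
  have "A *\<^sub>v 0\<^sub>v n = 0\<^sub>v n" using assms(1) by (intro eq_vecI) auto
  then show ?thesis unfolding one_pCons using assms by (simp add: poly_mat_eval_pCons_vec)
qed

lemma poly_mat_eval_add_vec:
  assumes A: "A \<in> carrier_mat n n" and v: "v \<in> carrier_vec n"
  shows "poly_mat_eval (p + q) A *\<^sub>v v = poly_mat_eval p A *\<^sub>v v + poly_mat_eval q A *\<^sub>v v"
proof (induction p q rule: poly_induct2)
  case (pCons a p b q)
  let ?P = "poly_mat_eval p A *\<^sub>v v" and ?Q = "poly_mat_eval q A *\<^sub>v v"
  have c: "?P \<in> carrier_vec n" "?Q \<in> carrier_vec n" using A v by auto
  have "A *\<^sub>v (?P + ?Q) = A *\<^sub>v ?P + A *\<^sub>v ?Q"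
    using A c by (rule mult_add_distrib_mat_vec)
  moreover have "A *\<^sub>v ?P \<in> carrier_vec n" "A *\<^sub>v ?Q \<in> carrier_vec n" using A c by auto
  ultimately show ?case using A v pCons
    by (auto simp: poly_mat_eval_pCons_vec[OF A v] algebra_simps intro!: eq_vecI)
qed (use A v in simp)

lemma poly_mat_eval_smult_vec:
  assumes A: "A \<in> carrier_mat n n" and v: "v \<in> carrier_vec n"
  shows "poly_mat_eval (Polynomial.smult c p) A *\<^sub>v v = c \<cdot>\<^sub>v (poly_mat_eval p A *\<^sub>v v)"
proof (induction p)
  case 0
  show ?case using A v by (auto intro!: eq_vecI)
next
  case (pCons a p)
  let ?P = "poly_mat_eval p A *\<^sub>v v"
  have c: "?P \<in> carrier_vec n" using A v by auto
  have "A *\<^sub>v (c \<cdot>\<^sub>v ?P) = c \<cdot>\<^sub>v (A *\<^sub>v ?P)" using A c by (auto intro!: eq_vecI)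
  moreover have "A *\<^sub>v ?P \<in> carrier_vec n" using A c by auto
  ultimately show ?case using A v pCons
    by (auto simp: poly_mat_eval_pCons_vec[OF A v] algebra_simps intro!: eq_vecI)
qed

lemma poly_mat_eval_mult_vec:
  assumes A: "A \<in> carrier_mat n n" and v: "v \<in> carrier_vec n"
  shows "poly_mat_eval (p * q) A *\<^sub>v v = poly_mat_eval p A *\<^sub>v (poly_mat_eval q A *\<^sub>v v)"
proof (induction p)
  case 0
  show ?case using A v by simp
next
  case (pCons a p)
  have c: "poly_mat_eval q A *\<^sub>v v \<in> carrier_vec n" using A v by auto
  have [simp]: "0 \<cdot>\<^sub>v v = 0\<^sub>v n" using v by auto
  have "A *\<^sub>v (poly_mat_eval (p * q) A *\<^sub>v v) \<in> carrier_vec n" using A v by auto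
  then show ?case using A v pCons c
    by (simp add: poly_mat_eval_pCons_vec poly_mat_eval_add_vec poly_mat_eval_smult_vec)
qed

text \<open>
  The polynomials that annihilate a vector form an ideal.
\<close>

lemma poly_mat_eval_mult_vec_eq_0:
  assumes A: "A \<in> carrier_mat n n" and v: "v \<in> carrier_vec n"
    and q: "poly_mat_eval q A *\<^sub>v v = 0\<^sub>v n" and "q dvd p"
  shows "poly_mat_eval p A *\<^sub>v v = 0\<^sub>v n"
proof -
  obtain s where "p = s * q" using \<open>q dvd p\<close> by (metis dvdE mult.commute)
  then show ?thesis using A v q poly_mat_eval_carrier[OF A, of s]
    by (auto simp: poly_mat_eval_mult_vec[OF A v] intro!: eq_vecI)
qed

section \<open>Krylov matrices and companion matrices\<close>

definition krylov_mat :: "'a::comm_ring_1 mat \<Rightarrow> 'a vec \<Rightarrow> 'a mat" where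
  "krylov_mat A v = mat (dim_row A) (dim_row A) (\<lambda>(i, j). (A ^\<^sub>m j *\<^sub>v v) $ i)"

lemma krylov_mat_carrier [simp]:
  "A \<in> carrier_mat n n \<Longrightarrow> krylov_mat A v \<in> carrier_mat n n"
  by (auto simp: krylov_mat_def)

text \<open>
  Linear combinations of the Krylov vectors are the values \<open>p(A) v\<close> for \<open>p\<close> of degree less than \<open>n\<close>. The
  condition is put on coefficients rather than on the degree so that it is also meaningful for \<open>n = 0\<close>.
\<close>

lemma krylov_mat_mult_coeffs:
  assumes A: "A \<in> carrier_mat n n" and v: "v \<in> carrier_vec n"
    and p: "\<And>l. l \<ge> n \<Longrightarrow> Polynomial.coeff p l = 0"
  shows "krylov_mat A v *\<^sub>v vec n (Polynomial.coeff p) = poly_mat_eval p A *\<^sub>v v"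
proof (rule eq_vecI)
  fix i assume "i < dim_vec (poly_mat_eval p A *\<^sub>v v)"
  with A have i: "i < n" by (auto simp: poly_mat_eval_def)
  have "(poly_mat_eval p A *\<^sub>v v) $ i = (\<Sum>j<n. poly_mat_eval p A $$ (i, j) * v $ j)"
    using A v i poly_mat_eval_carrier[OF A, of p] by (simp add: scalar_prod_def atLeast0LessThan)
  also have "\<dots> = (\<Sum>j<n. \<Sum>l<n. Polynomial.coeff p l * ((A ^\<^sub>m l) $$ (i, j) * v $ j))"
    using A i p by (intro sum.cong refl, subst poly_mat_eval_index[of _ n _ _ n])
       (auto simp: sum_distrib_left mult_ac)
  also have "\<dots> = (\<Sum>l<n. \<Sum>j<n. Polynomial.coeff p l * ((A ^\<^sub>m l) $$ (i, j) * v $ j))"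
    by (rule sum.swap)
  also have "\<dots> = (krylov_mat A v *\<^sub>v vec n (Polynomial.coeff p)) $ i"
    using A v i
    by (simp add: krylov_mat_def scalar_prod_def atLeast0LessThan sum_distrib_left mult_ac)
  finally show "(krylov_mat A v *\<^sub>v vec n (Polynomial.coeff p)) $ i = (poly_mat_eval p A *\<^sub>v v) $ i" ..
qed (use A in \<open>auto simp: poly_mat_eval_def krylov_mat_def\<close>)

lemma vec_as_coeffs:
  fixes w :: "'a::comm_ring_1 vec"
  assumes "w \<in> carrier_vec n"
  obtains p where "vec n (Polynomial.coeff p) = w" "\<And>l. l \<ge> n \<Longrightarrow> Polynomial.coeff p l = 0"
proof
  let ?p = "\<Sum>j<n. Polynomial.monom (w $ j) j"
  have c: "Polynomial.coeff ?p l = (if l < n then w $ l else 0)" for l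
    by (simp add: coeff_sum)
  show "vec n (Polynomial.coeff ?p) = w" using assms by (auto simp: c)
  show "Polynomial.coeff ?p l = 0" if "l \<ge> n" for l using that by (simp add: c)
qed

lemma poly_mat_eval_monom_vec:
  assumes A: "A \<in> carrier_mat n n" and v: "v \<in> carrier_vec n"
  shows "poly_mat_eval (Polynomial.monom 1 l) A *\<^sub>v v = A ^\<^sub>m l *\<^sub>v v"
proof (induction l)
  case 0 
  then show ?case using A v by (simp add: poly_mat_eval_1_vec[unfolded one_pCons] monom_0)
next
  case (Suc l)
  have [simp]: "0 \<cdot>\<^sub>v v = 0\<^sub>v n" using v by auto
  have "A *\<^sub>v (A ^\<^sub>m l *\<^sub>v v) \<in> carrier_vec n"
    by (rule mult_mat_vec_carrier[OF A pow_mat_vec_carrier[OF A v]])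
  then show ?case using Suc A v
    by (simp add: monom_Suc poly_mat_eval_pCons_vec pow_mat_Suc_left[OF A] assoc_mult_mat_vec[of _ n n _ n]
       del: pow_mat.simps)
qed

lemma mat_unit_det_inverse:
  fixes K :: "'a::comm_ring_1 mat"
  assumes K: "K \<in> carrier_mat n n" and u: "det K * u = 1"
  obtains L where "L \<in> carrier_mat n n" "K * L = 1\<^sub>m n" "L * K = 1\<^sub>m n"
proof
  let ?L = "u \<cdot>\<^sub>m adj_mat K"
  show "?L \<in> carrier_mat n n" using adj_mat(1)[OF K] by simp
  have "(u * det K) \<cdot>\<^sub>m 1\<^sub>m n = (1\<^sub>m n :: 'a mat)" using u by (auto simp: mult.commute)
  moreover have "u \<cdot>\<^sub>m (det K \<cdot>\<^sub>m 1\<^sub>m n) = (u * det K) \<cdot>\<^sub>m 1\<^sub>m n"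
    by (intro eq_matI) auto
  ultimately show "K * ?L = 1\<^sub>m n" "?L * K = 1\<^sub>m n"
    using adj_mat[OF K] K by (auto simp: mult_smult_distrib[of _ n n _ n] mult_smult_assoc_mat[of _ n n _ n])
qed

lemma companion_mat_carrier:
  "Polynomial.degree p = n \<Longrightarrow> companion_mat p \<in> carrier_mat n n"
  by (auto simp: companion_mat_def Let_def)

text \<open>
  Compare columns: both sides have \<open>A\<^bsup>j+1\<^esup> v\<close> as their \<open>j\<close>-th column. On the right this is immediate except
  in the last column, where \<open>p(A) v = 0\<close> expresses \<open>A\<^bsup>n\<^esup> v\<close> through the lower powers.
\<close>

lemma krylov_mat_companion:
  assumes A: "A \<in> carrier_mat n n" and v: "v \<in> carrier_vec n"
    and p: "monic p" "Polynomial.degree p = n" and pA: "poly_mat_eval p A *\<^sub>v v = 0\<^sub>v n"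
  shows "A * krylov_mat A v = krylov_mat A v * companion_mat p"
proof (rule eq_matI)
  let ?K = "krylov_mat A v"
  fix i j assume "i < dim_row (?K * companion_mat p)" "j < dim_col (?K * companion_mat p)"
  with A p have ij: "i < n" "j < n" by (auto simp: krylov_mat_def companion_mat_def Let_def)
  have colK: "col ?K l = A ^\<^sub>m l *\<^sub>v v" if "l < n" for l
    using A that by (intro eq_vecI) (auto simp: krylov_mat_def)
  have "col (A * ?K) j = A *\<^sub>v (A ^\<^sub>m j *\<^sub>v v)"
    using A ij colK by (simp add: col_mult2[of _ n n _ n])
  also have "\<dots> = A ^\<^sub>m Suc j *\<^sub>v v"
    using A v unfolding pow_mat_Suc_left[OF A] by (simp add: assoc_mult_mat_vec[of _ n n _ n])
  finally have L: "col (A * ?K) j = A ^\<^sub>m Suc j *\<^sub>v v" .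
  have R: "col (?K * companion_mat p) j = ?K *\<^sub>v col (companion_mat p) j"
    using A ij companion_mat_carrier[OF p(2)] by (simp add: col_mult2[of _ n n _ n])
  have "?K *\<^sub>v col (companion_mat p) j = A ^\<^sub>m Suc j *\<^sub>v v"
  proof (cases "Suc j < n")
    case True
    have "col (companion_mat p) j = vec n (Polynomial.coeff (Polynomial.monom 1 (Suc j)))"
      using True p by (intro eq_vecI) (auto simp: companion_mat_def Let_def)
    then show ?thesis using True A v krylov_mat_mult_coeffs[OF A v, of "Polynomial.monom 1 (Suc j)"]
      by (simp add: poly_mat_eval_monom_vec del: pow_mat.simps)
  next
    case False
    \<comment> \<open>The last column of the companion matrix lists the coefficients of \<open>t\<^bsup>n\<^esup> - p\<close>.\<close>
    define q where "q = Polynomial.monom 1 n - p"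
    have "col (companion_mat p) j = vec n (Polynomial.coeff q)"
      using False ij p by (intro eq_vecI) (auto simp: companion_mat_def Let_def q_def)
    moreover have "Polynomial.coeff q l = 0" if "l \<ge> n" for l
      using p that by (cases "l = n") (auto simp: q_def coeff_eq_0)
    ultimately have "?K *\<^sub>v col (companion_mat p) j = poly_mat_eval q A *\<^sub>v v"
      using krylov_mat_mult_coeffs[OF A v, of q] by simp
    moreover have "poly_mat_eval (q + p) A *\<^sub>v v = poly_mat_eval q A *\<^sub>v v"
      using A v pA by (simp add: poly_mat_eval_add_vec)
    moreover have "q + p = Polynomial.monom 1 (Suc j)" using False ij by (simp add: q_def)
       (metis Suc_lessI)
    ultimately show ?thesis using A v by (simp add: poly_mat_eval_monom_vec del: pow_mat.simps)
  qed
  with L R have "col (A * ?K) j = col (?K * companion_mat p) j" by simp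
  then have "col (A * ?K) j $ i = col (?K * companion_mat p) j $ i" by simp
  then show "(A * ?K) $$ (i, j) = (?K * companion_mat p) $$ (i, j)"
    using ij A companion_mat_carrier[OF p(2)] by (simp add: krylov_mat_def)
qed (use A companion_mat_carrier[OF p(2)] in \<open>auto simp: krylov_mat_def\<close>)

lemma similar_companion_mat:
  assumes A: "A \<in> carrier_mat n n" and v: "v \<in> carrier_vec n"
    and p: "monic p" "Polynomial.degree p = n" and pA: "poly_mat_eval p A *\<^sub>v v = 0\<^sub>v n"
    and u: "det (krylov_mat A v) * u = 1"
  shows "similar_mat A (companion_mat p)"
proof -
  let ?K = "krylov_mat A v" and ?C = "companion_mat p"
  have K: "?K \<in> carrier_mat n n" and C: "?C \<in> carrier_mat n n"
    using A companion_mat_carrier[OF p(2)] by auto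
  obtain L where L: "L \<in> carrier_mat n n" "?K * L = 1\<^sub>m n" "L * ?K = 1\<^sub>m n"
    using mat_unit_det_inverse[OF K u] .
  have "?K * ?C * L = A * ?K * L" using krylov_mat_companion[OF A v p pA] by simp
  also have "\<dots> = A * (?K * L)" using A K L(1) by (rule assoc_mult_mat)
  also have "\<dots> = A" using A L by simp
  finally have "A = ?K * ?C * L" ..
  then show ?thesis
    by (intro similar_matI[of _ _ ?K L n]) (use A K C L in \<open>auto simp del: assoc_mult_mat\<close>)
qed

text \<open>
  Laplace expansion along the first row, by induction on \<open>p = c + t q\<close>: only the corner entries \<open>t\<close> and \<open>c\<close>
  contribute. Deleting the first row and column leaves the matrix for \<open>q\<close>; deleting the first row and the
  last column leaves a triangular matrix with \<open>-1\<close> on the diagonal, whose sign cancels that of the cofactor.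
\<close>

lemma char_poly_companion_mat:
  fixes p :: "'a::comm_ring_1 poly"
  assumes "monic p"
  shows "char_poly (companion_mat p) = p"
  using assms
proof (induction p)
  case 0
  then show ?case by simp
next
  case (pCons c q)
  show ?case
  proof (cases "q = 0")
    case True
    with pCons have "c = 1" by simp
    have d: "Polynomial.degree [:1 :: 'a:] = 0" by simp
    show ?thesis unfolding True \<open>c = 1\<close>
      unfolding char_poly_def char_poly_matrix_def companion_mat_def Let_def d
      by (subst det_dim_zero) (auto simp: one_pCons)
  next
    case False
    define d where "d = Polynomial.degree q"
    have deg: "Polynomial.degree (pCons c q) = Suc d" using False by (simp add: d_def)
    have q: "monic q" "char_poly (companion_mat q) = q" using pCons False by auto
    let ?X = "char_poly_matrix (companion_mat (pCons c q))"
    have X: "?X \<in> carrier_mat (Suc d) (Suc d)"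
      using companion_mat_carrier[OF deg] by simp
    have Xij: "?X $$ (i, j) = (if i = j then [:0, 1:] else 0) -
        [: if j = d then - Polynomial.coeff (pCons c q) i else if i = j + 1 then 1 else 0 :]"
      if "i < Suc d" "j < Suc d" for i j
      using that unfolding char_poly_matrix_def companion_mat_def Let_def deg by auto
    have del0: "mat_delete ?X 0 0 = char_poly_matrix (companion_mat q)"
    proof (rule eq_matI)
      fix i j assume "i < dim_row (char_poly_matrix (companion_mat q))"
        "j < dim_col (char_poly_matrix (companion_mat q))"
      then have ij: "i < d" "j < d" by (auto simp: char_poly_matrix_def companion_mat_def Let_def d_def)
      then have "mat_delete ?X 0 0 $$ (i, j) = ?X $$ (Suc i, Suc j)"
        using X by (simp add: mat_delete_def)
      also have "\<dots> = char_poly_matrix (companion_mat q) $$ (i, j)"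
        using ij by (subst Xij) (auto simp: char_poly_matrix_def companion_mat_def Let_def simp flip: d_def)
      finally show "mat_delete ?X 0 0 $$ (i, j) = char_poly_matrix (companion_mat q) $$ (i, j)" .
    qed (use X in \<open>auto simp: mat_delete_def char_poly_matrix_def companion_mat_def Let_def d_def\<close>)
    have cof0: "cofactor ?X 0 0 = q"
      using q(2) by (simp add: cofactor_def del0 char_poly_def)
    have Y: "mat_delete ?X 0 d \<in> carrier_mat d d" using X by (auto simp: mat_delete_def)
    have Yij: "mat_delete ?X 0 d $$ (i, j) = ?X $$ (Suc i, j)" if "i < d" "j < d" for i j
      using that X by (simp add: mat_delete_def)
    have "upper_triangular (mat_delete ?X 0 d)"
      using Y by (auto simp: upper_triangular_def Yij Xij)
    then have "det (mat_delete ?X 0 d) = prod_list (diag_mat (mat_delete ?X 0 d))"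
      using Y by (rule det_upper_triangular)
    also have "\<dots> = (\<Prod>i<d. mat_delete ?X 0 d $$ (i, i))"
      using carrier_matD(1)[OF Y] by (simp only: prod_list_diag_prod atLeast0LessThan)
    also have "\<dots> = (\<Prod>i<d. - 1)"
      by (rule prod.cong) (auto simp: Yij Xij one_pCons)
    finally have "det (mat_delete ?X 0 d) = (- 1) ^ d" by simp
    then have cofd: "cofactor ?X 0 d = 1"
      by (simp add: cofactor_def flip: power_mult_distrib)
    have "det ?X = (\<Sum>j<Suc d. ?X $$ (0, j) * cofactor ?X 0 j)"
      using X by (rule laplace_expansion_row) simp
    also have "\<dots> = pCons c q"
    proof (cases "d = 0")
      case True
      \<comment> \<open>For a matrix of size one the two corners coincide, in the entry \<open>t + c\<close>.\<close>
      then have "q = 1" using q(1) unfolding d_def by (metis monic_degree_0)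
      with True cofd show ?thesis using Xij[of 0 0] by (simp add: one_pCons)
    next
      case False
      then have "(\<Sum>j<Suc d. ?X $$ (0, j) * cofactor ?X 0 j) =
                 (\<Sum>j\<in>{0, d}. ?X $$ (0, j) * cofactor ?X 0 j)"
        by (intro sum.mono_neutral_right) (auto simp: Xij)
      also have "\<dots> = [:0, 1:] * q + [:c:]"
        using False by (simp add: cof0 cofd Xij)
      finally show ?thesis by simp
    qed
    finally show ?thesis by (simp add: char_poly_def)
  qed
qed

text \<open>
  The inverse of the Krylov matrix yields a monic \<open>p\<close> of degree \<open>n\<close> with \<open>p(A) v = 0\<close>. Since \<open>A\<close> is conjugate
  to the companion matrix of \<open>p\<close>, both have characteristic polynomial \<open>p\<close>; so \<open>p\<close> is the characteristic
  polynomial of \<open>A\<close>.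
\<close>

lemma similar_companion_char_poly:
  assumes A: "A \<in> carrier_mat n n" and v: "v \<in> carrier_vec n"
    and u: "det (krylov_mat A v) * u = 1"
  shows "similar_mat A (companion_mat (char_poly A))"
proof -
  let ?K = "krylov_mat A v"
  have K: "?K \<in> carrier_mat n n" using A by simp
  obtain L where L: "L \<in> carrier_mat n n" "?K * L = 1\<^sub>m n" "L * ?K = 1\<^sub>m n"
    using mat_unit_det_inverse[OF K u] .
  let ?w = "A ^\<^sub>m n *\<^sub>v v"
  have w: "?w \<in> carrier_vec n" "L *\<^sub>v ?w \<in> carrier_vec n" 
    using L(1) pow_mat_vec_carrier[OF A v, of n] by auto
  obtain q where q: "vec n (Polynomial.coeff q) = L *\<^sub>v ?w"
      "\<And>l. l \<ge> n \<Longrightarrow> Polynomial.coeff q l = 0"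
    using vec_as_coeffs[OF w(2)] by blast
  have "poly_mat_eval q A *\<^sub>v v = ?K *\<^sub>v (L *\<^sub>v ?w)"
    using krylov_mat_mult_coeffs[OF A v q(2)] by (simp add: q(1))
  also have "\<dots> = (?K * L) *\<^sub>v ?w" by (rule assoc_mult_mat_vec[OF K L(1) w(1), symmetric])
  finally have qA: "poly_mat_eval q A *\<^sub>v v = ?w" using L w by simp
  define p where "p = Polynomial.monom 1 n - q"
  have cp: "Polynomial.coeff p n = 1" "\<And>l. l > n \<Longrightarrow> Polynomial.coeff p l = 0"
    using q(2) by (auto simp: p_def)
  have "poly_mat_eval (p + q) A *\<^sub>v v = poly_mat_eval p A *\<^sub>v v + ?w"
    using poly_mat_eval_add_vec[OF A v] qA by simp
  then have "poly_mat_eval p A *\<^sub>v v + ?w = ?w"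
    using A v by (simp add: p_def poly_mat_eval_monom_vec)
  then have pA: "poly_mat_eval p A *\<^sub>v v = 0\<^sub>v n"
    by (rule vec_eq_zeroI[OF poly_mat_eval_vec_carrier[OF A v] w(1)])
  have "Polynomial.degree p = n"
    using cp by (metis coeff_0 leading_coeff_0_iff le_degree linorder_neqE_nat not_le zero_neq_one)
  then have "similar_mat A (companion_mat p)"
    using cp similar_companion_mat[OF A v _ _ pA u] by simp
  with cp \<open>Polynomial.degree p = n\<close> show ?thesis
    using char_poly_similar[of A "companion_mat p"] char_poly_companion_mat[of p] by simp
qed

section \<open>Krylov determinants of primary vectors over a field\<close>

text \<open>
  A vanishing determinant gives a nonzero polynomial of degree less than \<open>n\<close> that annihilates \<open>v\<close>. A nonzero
  annihilator \<open>m\<close> of least degree divides \<open>f\<^bsup>r+1\<^esup> = h m\<close>. If the prime \<open>f\<close> divides \<open>h\<close>, then \<open>m\<close> divides \<open>f\<^bsup>r\<^esup>\<close>,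
  contrary to \<open>f\<^bsup>r\<^esup>(B) v \<noteq> 0\<close>; otherwise \<open>f\<^bsup>r+1\<^esup>\<close> divides \<open>m\<close>, whose degree is too small.
\<close>

lemma krylov_det_nonzero:
  fixes B :: "'k::field mat"
  assumes B: "B \<in> carrier_mat n n" and v: "v \<in> carrier_vec n"
    and irr: "Factorial_Ring.irreducible f" and n: "n = Polynomial.degree (f ^ Suc r)"
    and r1: "poly_mat_eval (f ^ r) B *\<^sub>v v \<noteq> 0\<^sub>v n"
    and r2: "poly_mat_eval (f ^ Suc r) B *\<^sub>v v = 0\<^sub>v n"
  shows "det (krylov_mat B v) \<noteq> 0"
proof
  assume "det (krylov_mat B v) = 0"
  then obtain w where w: "w \<in> carrier_vec n" "w \<noteq> 0\<^sub>v n" "krylov_mat B v *\<^sub>v w = 0\<^sub>v n"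
    using det_0_iff_vec_prod_zero[OF krylov_mat_carrier[OF B]] by blast
  obtain q where q: "vec n (Polynomial.coeff q) = w" "\<And>l. l \<ge> n \<Longrightarrow> Polynomial.coeff q l = 0"
    using vec_as_coeffs[OF w(1)] by blast
  define ann where "ann p \<longleftrightarrow> p \<noteq> 0 \<and> poly_mat_eval p B *\<^sub>v v = 0\<^sub>v n" for p
  have "q \<noteq> 0" using q w(2) by auto
  then have "ann q" using krylov_mat_mult_coeffs[OF B v q(2)] q(1) w(3) by (simp add: ann_def)
  then obtain m where m: "ann m" "\<And>p. ann p \<Longrightarrow> Polynomial.degree m \<le> Polynomial.degree p"
    using ex_has_least_nat[of ann q Polynomial.degree] by blast
  have mv: "poly_mat_eval m B *\<^sub>v v = 0\<^sub>v n" and "m \<noteq> 0" using m(1) by (auto simp: ann_def)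
  have "Polynomial.degree m < n"
    using m(2)[OF \<open>ann q\<close>] q(2) \<open>q \<noteq> 0\<close> by (metis leading_coeff_0_iff le_less_trans not_le)
  have "m dvd f ^ Suc r"
  proof (rule ccontr)
    assume nd: "\<not> m dvd f ^ Suc r"
    let ?s = "f ^ Suc r mod m"
    have "poly_mat_eval (?s + (f ^ Suc r div m) * m) B *\<^sub>v v = 0\<^sub>v n"
      using r2 by (simp only: mod_div_mult_eq)
    moreover have "poly_mat_eval ((f ^ Suc r div m) * m) B *\<^sub>v v = 0\<^sub>v n"
      by (rule poly_mat_eval_mult_vec_eq_0[OF B v mv dvd_triv_right])
    ultimately have "poly_mat_eval ?s B *\<^sub>v v + 0\<^sub>v n = 0\<^sub>v n"
      using poly_mat_eval_add_vec[OF B v] by metis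
    then have "poly_mat_eval ?s B *\<^sub>v v = 0\<^sub>v n"
      by (rule vec_eq_zeroI[OF poly_mat_eval_vec_carrier[OF B v] zero_carrier_vec])
    with nd have "ann ?s" unfolding ann_def using mod_eq_0_iff_dvd by blast
    moreover have "Polynomial.degree ?s < Polynomial.degree m"
      using nd \<open>m \<noteq> 0\<close> mod_eq_0_iff_dvd by (intro degree_mod_less') blast+
    ultimately show False using m(2) by fastforce
  qed
  then obtain h where h: "f ^ Suc r = h * m" by (metis dvdE mult.commute)
  have prime: "prime_elem f" using irr by (rule field_poly_irreducible_imp_prime)
  show False
  proof (cases "f dvd h")
    case True
    then obtain h' where "h = f * h'" unfolding dvd_def by blast
    with h prime have "f ^ r = h' * m" by (auto simp: prime_elem_def mult_ac)
    then have "poly_mat_eval (f ^ r) B *\<^sub>v v = 0\<^sub>v n"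
      using poly_mat_eval_mult_vec_eq_0[OF B v mv] by simp
    with r1 show False by simp
  next
    case False
    have "f ^ Suc r dvd m"
      by (rule prime_power_dvd_multD[OF prime _ _ False]) (use h in auto)
    then have "n \<le> Polynomial.degree m"
      using \<open>m \<noteq> 0\<close> unfolding n by (intro dvd_imp_degree_le)
    with \<open>Polynomial.degree m < n\<close> show False by simp
  qed
qed

section \<open>Units of a finite local ring\<close>

text \<open>
  If \<open>a\<close> generated a proper ideal, then among the proper ideals that contain \<open>a\<close>, of which there are only
  finitely many, a largest one would be a maximal ideal, hence equal to \<open>M\<close>.
\<close>

lemma unit_outside_maximalideal:
  fixes a :: "'a::comm_ring_1"
  assumes fin: "finite (UNIV :: 'a set)"
    and unique: "\<exists>!M. maximalideal M (ring_of_type_algebra :: 'a ring)"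
    and M: "maximalideal M (ring_of_type_algebra :: 'a ring)" and a: "a \<notin> M"
  obtains u where "a * u = 1"
proof -
  let ?R = "ring_of_type_algebra :: 'a ring"
  interpret R: cring ?R by (rule cring_from_type_algebra)
  have sel: "carrier ?R = UNIV" "x \<otimes>\<^bsub>?R\<^esub> y = x * y" "\<one>\<^bsub>?R\<^esub> = 1" for x y
    by (auto simp: ring_of_type_algebra_def)
  let ?S = "{J. ideal J ?R \<and> a \<in> J \<and> J \<noteq> UNIV}"
  have "PIdl\<^bsub>?R\<^esub> a \<notin> ?S"
  proof
    assume "PIdl\<^bsub>?R\<^esub> a \<in> ?S"
    moreover have "finite ?S" using fin by (simp add: Finite_Set.finite_set)
    ultimately obtain N where N: "N \<in> ?S" "\<And>J. J \<in> ?S \<Longrightarrow> N \<subseteq> J \<Longrightarrow> N = J"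
      using finite_has_maximal[of ?S] by blast
    have "maximalideal N ?R"
      using N by (intro maximalidealI) (auto simp: sel)
    with unique M have "N = M" by blast
    with N a show False by auto
  qed
  moreover have "ideal (PIdl\<^bsub>?R\<^esub> a) ?R" "a \<in> PIdl\<^bsub>?R\<^esub> a"
    by (auto intro!: R.cgenideal_ideal R.cgenideal_self simp: sel)
  ultimately have "1 \<in> PIdl\<^bsub>?R\<^esub> a" by auto
  then obtain u where "u * a = 1" by (auto simp: cgenideal_def sel)
  then show ?thesis using that by (simp add: mult.commute)
qed

section \<open>Separability over a finite field\<close>

text \<open>
  The Frobenius map is additive with trivial kernel, and an injective map of a finite set to itself is onto.
\<close>

lemma Frobenius_surj:
  fixes x :: "'k::field"
  assumes fin: "finite (UNIV :: 'k set)"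
  obtains y :: 'k where "y ^ CHAR('k) = x"
proof -
  let ?p = "CHAR('k)"
  have p: "Factorial_Ring.prime ?p" using finite_imp_CHAR_pos[OF fin] by (rule prime_CHAR_semidom)
  have "inj (\<lambda>y :: 'k. y ^ ?p)"
  proof (rule injI)
    fix y z :: 'k assume "y ^ ?p = z ^ ?p"
    moreover have "((y - z) + z) ^ ?p = (y - z) ^ ?p + z ^ ?p"
      using p by (rule freshmans_dream) simp
    ultimately show "y = z" by simp
  qed
  then have "surj (\<lambda>y :: 'k. y ^ ?p)" using fin by (rule finite_UNIV_inj_surj[rotated])
  then show ?thesis using that by (metis surjD)
qed

text \<open>
  If \<open>f' = 0\<close>, only powers of \<open>t\<close> with exponent divisible by the characteristic \<open>p\<close> occur in \<open>f\<close>. Taking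
  \<open>p\<close>-th roots of the coefficients then writes \<open>f\<close> as a \<open>p\<close>-th power.
\<close>

lemma pderiv_irreducible_nonzero:
  fixes f :: "'k::field poly"
  assumes fin: "finite (UNIV :: 'k set)" and irr: "Factorial_Ring.irreducible f"
  shows "pderiv f \<noteq> 0"
proof
  assume f': "pderiv f = 0"
  let ?p = "CHAR('k)"
  have p: "Factorial_Ring.prime ?p" using finite_imp_CHAR_pos[OF fin] by (rule prime_CHAR_semidom)
  then have "?p > 1" by (rule prime_gt_1_nat)
  have coeff0: "Polynomial.coeff f l = 0" if "\<not> ?p dvd l" for l
  proof (cases l)
    case (Suc i)
    have "of_nat (Suc i) * Polynomial.coeff f (Suc i) = Polynomial.coeff (pderiv f) i"
      by (simp add: coeff_pderiv)
    with f' that Suc show ?thesis by (simp add: of_nat_eq_0_iff_char_dvd del: of_nat_Suc)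
  qed (use that in simp)
  define root where "root x = (SOME y :: 'k. y ^ ?p = x)" for x
  have root: "root x ^ ?p = x" for x
  proof -
    obtain y where "y ^ ?p = x" using Frobenius_surj[OF fin] .
    then show ?thesis unfolding root_def by (rule someI)
  qed
  define g where "g = (\<Sum>i\<le>Polynomial.degree f. Polynomial.monom (root (Polynomial.coeff f (?p * i))) i)"
  have "g ^ ?p = (\<Sum>i\<le>Polynomial.degree f. Polynomial.monom (root (Polynomial.coeff f (?p * i))) i ^ ?p)"
    unfolding g_def using p by (intro freshmans_dream_sum) auto
  also have "\<dots> = (\<Sum>i\<le>Polynomial.degree f. Polynomial.monom (Polynomial.coeff f (?p * i)) (?p * i))"
    by (simp add: monom_power root mult.commute)
  also have "\<dots> = f"
  proof (rule poly_eqI)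
    fix l
    have "(\<Sum>i\<le>Polynomial.degree f. Polynomial.coeff (Polynomial.monom (Polynomial.coeff f (?p * i)) (?p * i)) l) =
          (\<Sum>i\<le>Polynomial.degree f. if ?p * i = l then Polynomial.coeff f l else 0)"
      by (intro sum.cong) auto
    also have "\<dots> = Polynomial.coeff f l"
    proof (cases "?p dvd l \<and> l \<le> Polynomial.degree f")
      case True
      then obtain i where i: "l = ?p * i" by auto
      with True \<open>?p > 1\<close> have "i \<le> Polynomial.degree f"
        by (metis le_trans le_square mult.commute mult_le_mono1 nat_mult_1 less_imp_le)
      moreover have "?p * j = l \<longleftrightarrow> j = i" for j using i \<open>?p > 1\<close> by auto
      ultimately show ?thesis by (simp add: sum.delta)
    next
      case False
      then have "Polynomial.coeff f l = 0" using coeff0 coeff_eq_0[of f l] by fastforce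
      then show ?thesis by (auto intro: sum.neutral)
    qed
    finally show "Polynomial.coeff (\<Sum>i\<le>Polynomial.degree f.
        Polynomial.monom (Polynomial.coeff f (?p * i)) (?p * i)) l = Polynomial.coeff f l"
      by (simp add: coeff_sum)
  qed
  finally have g: "g ^ ?p = f" .
  then have "f = g * g ^ (?p - 1)"
    using \<open>?p > 1\<close> by (cases ?p) auto
  then have "g dvd 1 \<or> g ^ (?p - 1) dvd 1" by (rule comm_semiring_1_class.irreducibleD[OF irr])
  then have "g dvd 1" unfolding is_unit_power_iff using \<open>?p > 1\<close> by linarith
  then have "f dvd 1" unfolding g[symmetric] is_unit_power_iff by blast
  with irr show False unfolding Factorial_Ring.irreducible_def by blast
qed

section \<open>The generalised Jordan block as multiplication by \<open>t + y\<close>\<close>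

lemma sum_blocks:
  fixes g :: "nat \<Rightarrow> 'b::comm_monoid_add"
  shows "(\<Sum>i<r * d. g i) = (\<Sum>m<r. \<Sum>c<d. g (m * d + c))"
proof -
  have "(\<Sum>i<r * d. g i) = (\<Sum>m<r. sum g {m * d..<m * d + d})"
    by (rule sum.nat_group[symmetric])
  also have "\<dots> = (\<Sum>m<r. \<Sum>c<d. g (m * d + c))"
  proof (rule sum.cong)
    fix m
    show "sum g {m * d..<m * d + d} = (\<Sum>c<d. g (m * d + c))"
      using sum.shift_bounds_nat_ivl[of g 0 "m * d" d] by (simp add: atLeast0LessThan add.commute)
  qed simp
  finally show ?thesis .
qed

text \<open>
  A vector with \<open>r\<close> blocks of length \<open>d\<close> becomes a polynomial in \<open>y\<close> over \<open>R[t]\<close>: the \<open>c\<close>-th entry of the \<open>k\<close>-th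
  block is the coefficient of \<open>t\<^bsup>c\<^esup> y\<^bsup>k\<^esup>\<close>.
\<close>

definition block_poly :: "nat \<Rightarrow> 'a::comm_ring_1 vec \<Rightarrow> nat \<Rightarrow> 'a poly" where
  "block_poly d w k = (\<Sum>c<d. Polynomial.monom (w $ (k * d + c)) c)"

definition bivariate :: "nat \<Rightarrow> nat \<Rightarrow> 'a::comm_ring_1 vec \<Rightarrow> 'a poly poly" where
  "bivariate d r w = (\<Sum>k<r. Polynomial.monom (block_poly d w k) k)"

lemma coeff_block_poly:
  "Polynomial.coeff (block_poly d w k) c = (if c < d then w $ (k * d + c) else 0)"
  by (simp add: block_poly_def coeff_sum)

lemma coeff_bivariate:
  "Polynomial.coeff (bivariate d r w) k = (if k < r then block_poly d w k else 0)"
  by (simp add: bivariate_def coeff_sum)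

text \<open>
  Membership of \<open>g\<close> in the ideal \<open>(F(t), y\<^bsup>r\<^esup>)\<close> of \<open>R[t, y]\<close>, the outer variable being \<open>y\<close>: modulo \<open>y\<^bsup>r\<^esup>\<close>
  only the coefficients of \<open>y\<^bsup>k\<^esup>\<close> with \<open>k < r\<close> matter.
\<close>

definition in_ideal :: "'a::comm_ring_1 poly \<Rightarrow> nat \<Rightarrow> 'a poly poly \<Rightarrow> bool" where
  "in_ideal F r g \<longleftrightarrow> (\<forall>k<r. F dvd Polynomial.coeff g k)"

lemma in_ideal_add: "in_ideal F r g \<Longrightarrow> in_ideal F r h \<Longrightarrow> in_ideal F r (g + h)"
  by (simp add: in_ideal_def)

lemma in_ideal_minus: "in_ideal F r g \<Longrightarrow> in_ideal F r (- g)"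
  by (simp add: in_ideal_def)

lemma in_ideal_mult: "in_ideal F r g \<Longrightarrow> in_ideal F r (h * g)"
  by (auto simp: in_ideal_def coeff_mult intro!: dvd_sum dvd_mult)

lemma in_ideal_const_dvd: "[:F:] dvd g \<Longrightarrow> in_ideal F r g"
  by (auto simp: in_ideal_def)

text \<open>
  The companion matrix of \<open>F\<close> is multiplication by \<open>t\<close> on \<open>R[t] / F\<close>. The correction term removes the leading
  coefficient of \<open>t u(t)\<close>.
\<close>

lemma companion_mat_acts_as_shift:
  fixes F :: "'a::comm_ring_1 poly"
  assumes F: "monic F" and d: "d = Polynomial.degree F" "d > 0"
  shows "(\<Sum>c<d. Polynomial.monom (\<Sum>e<d. companion_mat F $$ (c, e) * u e) c) =
    [:0, 1:] * (\<Sum>c<d. Polynomial.monom (u c) c) - Polynomial.smult (u (d - 1)) F"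
proof (rule poly_eqI)
  fix l
  obtain d' where d': "d = Suc d'" using d(2) by (cases d) auto
  let ?P = "\<Sum>c<d. Polynomial.monom (u c) c"
  have P: "Polynomial.coeff ([:0, 1:] * ?P) l = (if 0 < l \<and> l \<le> d then u (l - 1) else 0)"
    by (cases l) (auto simp: coeff_sum)
  have row: "(\<Sum>e<d. companion_mat F $$ (l, e) * u e) =
      (if 0 < l then u (l - 1) else 0) - Polynomial.coeff F l * u d'" if "l < d"
  proof -
    have "companion_mat F $$ (l, e) * u e = (if e = l - 1 then (if 0 < l then u e else 0) else 0)"
      if "e < d'" for e
      using that \<open>l < d\<close> d' by (auto simp: companion_mat_def Let_def d'[unfolded d(1)])
    moreover have "companion_mat F $$ (l, d') = - Polynomial.coeff F l"
      using \<open>l < d\<close> d' by (auto simp: companion_mat_def Let_def d'[unfolded d(1)])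
    ultimately have "(\<Sum>e<d. companion_mat F $$ (l, e) * u e) =
        (\<Sum>e<d'. if e = l - 1 then (if 0 < l then u e else 0) else 0) - Polynomial.coeff F l * u d'"
      unfolding d' sum.lessThan_Suc by simp
    also have "\<dots> = (if 0 < l then u (l - 1) else 0) - Polynomial.coeff F l * u d'"
      using that by (auto simp: d' sum.delta')
    finally show ?thesis .
  qed
  have Fl: "Polynomial.coeff F l = (if l = d then 1 else 0)" if "l \<ge> d"
    using that F d(1) by (auto intro: coeff_eq_0)
  show "Polynomial.coeff (\<Sum>c<d. Polynomial.monom (\<Sum>e<d. companion_mat F $$ (c, e) * u e) c) l =
        Polynomial.coeff ([:0, 1:] * ?P - Polynomial.smult (u (d - 1)) F) l"
  proof (cases "l < d")
    case True
    then have "Polynomial.coeff (\<Sum>c<d. Polynomial.monom (\<Sum>e<d. companion_mat F $$ (c, e) * u e) c) l =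
        (\<Sum>e<d. companion_mat F $$ (l, e) * u e)"
      by (simp add: coeff_sum)
    with True show ?thesis unfolding coeff_diff P row[OF True] by (simp add: d' mult.commute)
  next
    case False
    then have "Polynomial.coeff (\<Sum>c<d. Polynomial.monom (\<Sum>e<d. companion_mat F $$ (c, e) * u e) c) l = 0"
      by (simp add: coeff_sum)
    with False Fl show ?thesis unfolding coeff_diff P by (auto simp: d')
  qed
qed

lemma jordan_companion_mat_carrier:
  "Polynomial.degree F = d \<Longrightarrow> jordan_companion_mat F r \<in> carrier_mat (r * d) (r * d)"
  by (simp add: jordan_companion_mat_def Let_def)

lemma block_index_less: "k < r \<Longrightarrow> c < d \<Longrightarrow> k * d + c < r * (d :: nat)"
proof -
  assume "k < r" "c < d"
  then have "k * d + c < Suc k * d" by simp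
  also have "\<dots> \<le> r * d" using \<open>k < r\<close> by (intro mult_le_mono1) simp
  finally show ?thesis .
qed

lemma jordan_companion_mat_mult_vec_index:
  fixes F :: "'a::comm_ring_1 poly"
  assumes d: "d = Polynomial.degree F" and w: "w \<in> carrier_vec (r * d)" and k: "k < r" and c: "c < d"
  shows "(jordan_companion_mat F r *\<^sub>v w) $ (k * d + c) =
    (\<Sum>e<d. companion_mat F $$ (c, e) * w $ (k * d + e)) + (if k = 0 then 0 else w $ ((k - 1) * d + c))"
proof -
  let ?J = "jordan_companion_mat F r"
  have J: "?J \<in> carrier_mat (r * d) (r * d)" using d by (simp add: jordan_companion_mat_carrier)
  have entry: "?J $$ (k * d + c, m * d + e) =
      (if k = m then companion_mat F $$ (c, e) else if k = m + 1 then (if c = e then 1 else 0) else 0)"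
    if "m < r" "e < d" for m e
  proof -
    have "(k * d + c) div d = k" "(k * d + c) mod d = c" "(m * d + e) div d = m" "(m * d + e) mod d = e"
      using c that by auto
    moreover have "?J $$ (k * d + c, m * d + e) =
        (if (k * d + c) div d = (m * d + e) div d then companion_mat F $$ ((k * d + c) mod d, (m * d + e) mod d)
         else if (k * d + c) div d = (m * d + e) div d + 1 then 1\<^sub>m d $$ ((k * d + c) mod d, (m * d + e) mod d)
         else 0)"
      unfolding jordan_companion_mat_def Let_def d[symmetric]
      by (subst index_mat(1)[OF block_index_less[OF k c] block_index_less[OF that]]) (simp only: split)
    ultimately show ?thesis using c that by (simp only: index_one_mat)
  qed
  have "(?J *\<^sub>v w) $ (k * d + c) = (\<Sum>j<r * d. ?J $$ (k * d + c, j) * w $ j)"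
    using J w block_index_less[OF k c] by (simp add: scalar_prod_def atLeast0LessThan)
  also have "\<dots> = (\<Sum>m<r. \<Sum>e<d. ?J $$ (k * d + c, m * d + e) * w $ (m * d + e))"
    by (rule sum_blocks)
  also have "\<dots> = (\<Sum>m<r. (if m = k then \<Sum>e<d. companion_mat F $$ (c, e) * w $ (k * d + e) else 0) +
      (if m = k - 1 then (if k = 0 then 0 else w $ ((k - 1) * d + c)) else 0))"
  proof (rule sum.cong)
    fix m assume "m \<in> {..<r}"
    then have "m < r" by simp
    then have "(\<Sum>e<d. ?J $$ (k * d + c, m * d + e) * w $ (m * d + e)) =
        (\<Sum>e<d. (if k = m then companion_mat F $$ (c, e) else if k = m + 1 then (if c = e then 1 else 0) else 0)
          * w $ (m * d + e))"
      by (intro sum.cong) (simp_all add: entry)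
    also have "\<dots> = (if m = k then \<Sum>e<d. companion_mat F $$ (c, e) * w $ (k * d + e) else 0) +
      (if m = k - 1 then (if k = 0 then 0 else w $ ((k - 1) * d + c)) else 0)"
    proof (cases "k = m + 1")
      case True
      have "(\<Sum>e<d. (if c = e then 1 else 0) * w $ (m * d + e)) = (\<Sum>e<d. if e = c then w $ (m * d + e) else 0)"
        by (rule sum.cong) auto
      with True c show ?thesis by simp
    qed auto
    finally show "(\<Sum>e<d. ?J $$ (k * d + c, m * d + e) * w $ (m * d + e)) = \<dots>" .
  qed simp
  also have "\<dots> = (\<Sum>e<d. companion_mat F $$ (c, e) * w $ (k * d + e)) + (if k = 0 then 0 else w $ ((k - 1) * d + c))"
    using k by (simp add: sum.distrib)
  finally show ?thesis .
qed

text \<open>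
  Modulo \<open>(F, y\<^bsup>r\<^esup>)\<close> the matrix acts as multiplication by \<open>t + y\<close>, written \<open>[:[:0, 1:], 1:]\<close>: the diagonal blocks
  multiply by \<open>t\<close>, and the identity blocks move block \<open>k - 1\<close> to block \<open>k\<close>.
\<close>

lemma bivariate_jordan_companion_mat:
  fixes F :: "'a::comm_ring_1 poly"
  assumes F: "monic F" and d: "d = Polynomial.degree F" "d > 0" and w: "w \<in> carrier_vec (r * d)"
  shows "in_ideal F r (bivariate d r (jordan_companion_mat F r *\<^sub>v w) - [:[:0, 1:], 1:] * bivariate d r w)"
  unfolding in_ideal_def
proof (intro allI impI)
  let ?J = "jordan_companion_mat F r"
  fix k assume k: "k < r"
  have "block_poly d (?J *\<^sub>v w) k =
      (\<Sum>c<d. Polynomial.monom (\<Sum>e<d. companion_mat F $$ (c, e) * w $ (k * d + e)) c) +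
      (if k = 0 then 0 else block_poly d w (k - 1))"
    by (simp add: block_poly_def jordan_companion_mat_mult_vec_index[OF d(1) w k] flip: add_monom sum.distrib)
  also have "\<dots> = [:0, 1:] * block_poly d w k - Polynomial.smult (w $ (k * d + (d - 1))) F +
      (if k = 0 then 0 else block_poly d w (k - 1))"
    unfolding companion_mat_acts_as_shift[OF F d] by (simp add: block_poly_def)
  finally have "Polynomial.coeff (bivariate d r (?J *\<^sub>v w) - [:[:0, 1:], 1:] * bivariate d r w) k =
      - Polynomial.smult (w $ (k * d + (d - 1))) F"
    using k by (cases k) (simp_all add: coeff_bivariate coeff_pCons)
  then show "F dvd Polynomial.coeff (bivariate d r (?J *\<^sub>v w) - [:[:0, 1:], 1:] * bivariate d r w) k"
    by (simp add: dvd_smult)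
qed

text \<open>
  The polynomial \<open>p(t + y)\<close>, whose coefficient of \<open>y\<^bsup>k\<^esup>\<close> is the \<open>k\<close>-th divided derivative of \<open>p\<close>.
\<close>

definition taylor_poly :: "'a::comm_ring_1 poly \<Rightarrow> 'a poly poly" where
  "taylor_poly p = poly (map_poly (\<lambda>c. [:[:c:]:]) p) [:[:0, 1:], 1:]"

lemma taylor_poly_0 [simp]: "taylor_poly 0 = 0"
  by (simp add: taylor_poly_def)

lemma taylor_poly_pCons:
  "taylor_poly (pCons a p) = [:[:a:]:] + [:[:0, 1:], 1:] * taylor_poly p"
proof -
  interpret comm_ring_hom "\<lambda>c :: 'a. [:[:c:]:]"
    by unfold_locales (auto simp: one_pCons)
  show ?thesis by (simp add: taylor_poly_def hom_distribs)
qed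

lemma taylor_poly_power: "taylor_poly (p ^ m) = taylor_poly p ^ m"
proof -
  interpret comm_ring_hom "\<lambda>c :: 'a. [:[:c:]:]"
    by unfold_locales (auto simp: one_pCons)
  interpret map_poly_hom: map_poly_comm_ring_hom "\<lambda>c :: 'a. [:[:c:]:]" ..
  show ?thesis by (simp add: taylor_poly_def map_poly_hom.hom_power)
qed

lemma coeff_0_taylor_poly: "Polynomial.coeff (taylor_poly F) 0 = F"
  by (induction F) (simp_all add: taylor_poly_pCons)

lemma coeff_1_taylor_poly:
  fixes F :: "'a::idom poly"
  shows "Polynomial.coeff (taylor_poly F) 1 = pderiv F"
  by (induction F) (simp_all add: taylor_poly_pCons coeff_0_taylor_poly pderiv_pCons)

lemma taylor_poly_pConsE:
  obtains h where "taylor_poly F = pCons F h"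
proof (cases "taylor_poly F")
  case (pCons a h)
  then show ?thesis using coeff_0_taylor_poly[of F] that by simp
qed

lemma block_poly_add: 
  "v \<in> carrier_vec (r * d) \<Longrightarrow> w \<in> carrier_vec (r * d) \<Longrightarrow> k < r \<Longrightarrow>
   block_poly d (v + w) k = block_poly d v k + block_poly d w k"
  by (intro poly_eqI) (auto simp: coeff_block_poly block_index_less)

lemma bivariate_add: 
  "v \<in> carrier_vec (r * d) \<Longrightarrow> w \<in> carrier_vec (r * d) \<Longrightarrow>
   bivariate d r (v + w) = bivariate d r v + bivariate d r w"
  by (intro poly_eqI) (auto simp: coeff_bivariate block_poly_add)

lemma bivariate_smult: 
  assumes "v \<in> carrier_vec (r * d)"
  shows "bivariate d r (a \<cdot>\<^sub>v v) = [:[:a:]:] * bivariate d r v"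
proof -
  have "block_poly d (a \<cdot>\<^sub>v v) k = Polynomial.smult a (block_poly d v k)" if "k < r" for k
    using assms that by (intro poly_eqI) (auto simp: coeff_block_poly block_index_less)
  then show ?thesis by (intro poly_eqI) (auto simp: coeff_bivariate)
qed

lemma bivariate_poly_mat_eval:
  fixes F :: "'a::comm_ring_1 poly"
  assumes F: "monic F" and d: "d = Polynomial.degree F" "d > 0" and w: "w \<in> carrier_vec (r * d)"
  shows "in_ideal F r (bivariate d r (poly_mat_eval q (jordan_companion_mat F r) *\<^sub>v w) -
      taylor_poly q * bivariate d r w)"
proof (induction q)
  have J: "jordan_companion_mat F r \<in> carrier_mat (r * d) (r * d)"
    using d by (simp add: jordan_companion_mat_carrier)
  {
    case 0
    have "bivariate d r (0\<^sub>v (r * d)) = (0 :: 'a poly poly)"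
      by (intro poly_eqI) (auto simp: coeff_bivariate coeff_block_poly block_index_less)
    then show ?case using J w by (simp add: in_ideal_def)
  next
    case (pCons a q)
    let ?J = "jordan_companion_mat F r" and ?x = "[:[:0, 1:], 1:] :: 'a poly poly"
    let ?u = "poly_mat_eval q ?J *\<^sub>v w"
    have u: "?u \<in> carrier_vec (r * d)" using J w by simp
    then have Ju: "?J *\<^sub>v ?u \<in> carrier_vec (r * d)" using J by simp
    have "bivariate d r (poly_mat_eval (pCons a q) ?J *\<^sub>v w) - taylor_poly (pCons a q) * bivariate d r w =
        (bivariate d r (?J *\<^sub>v ?u) - ?x * bivariate d r ?u) +
        ?x * (bivariate d r ?u - taylor_poly q * bivariate d r w)"
      using w Ju unfolding poly_mat_eval_pCons_vec[OF J w] taylor_poly_pCons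
      by (subst bivariate_add) (simp_all add: bivariate_smult algebra_simps del: mult_pCons_left mult_pCons_right)
    also have "in_ideal F r \<dots>"
      by (intro in_ideal_add in_ideal_mult pCons.IH bivariate_jordan_companion_mat F d u)
    finally show ?case .
  }
qed

text \<open>
  The blocks have degree less than that of the monic \<open>F\<close>, so they are reduced representatives of residue
  classes, and a vector is determined by its class modulo \<open>(F, y\<^bsup>r\<^esup>)\<close>.
\<close>

lemma bivariate_in_ideal_imp_0:
  fixes F :: "'a::comm_ring_1 poly"
  assumes F: "monic F" and d: "d = Polynomial.degree F" "d > 0" and w: "w \<in> carrier_vec (r * d)"
    and I: "in_ideal F r (bivariate d r w)"
  shows "w = 0\<^sub>v (r * d)"
proof (rule eq_vecI)
  fix i assume "i < dim_vec (0\<^sub>v (r * d) :: 'a vec)"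
  then have "i < r * d" by simp
  then have k: "i div d < r" by (simp add: less_mult_imp_div_less)
  let ?b = "block_poly d w (i div d)"
  have "F dvd ?b" using I k by (auto simp: in_ideal_def coeff_bivariate)
  then obtain h where h: "?b = F * h" by blast
  have "h = 0"
  proof (rule ccontr)
    assume "h \<noteq> 0"
    then have "Polynomial.degree ?b \<ge> d" using degree_monic_mult[OF F, of h] h d by simp
    moreover have "Polynomial.degree ?b \<le> d - 1"
      by (rule degree_le) (use d(2) in \<open>auto simp: coeff_block_poly\<close>)
    ultimately show False using d(2) by simp
  qed
  with h have "Polynomial.coeff ?b (i mod d) = 0" by simp
  then show "w $ i = 0\<^sub>v (r * d) $ i" using d(2) \<open>i < r * d\<close> by (simp add: coeff_block_poly)
qed (use w in simp)

lemma bivariate_unit_vec: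
  assumes "d > 0" "r > 0"
  shows "bivariate d r (unit_vec (r * d) 0) = 1"
proof (intro poly_eqI)
  fix k c
  show "Polynomial.coeff (Polynomial.coeff (bivariate d r (unit_vec (r * d) 0)) k) c =
        Polynomial.coeff (Polynomial.coeff 1 k) c"
    using assms block_index_less[of k r c d]
    by (auto simp: coeff_bivariate coeff_block_poly)
qed

text \<open>
  If \<open>F(t + y) = F + y h\<close>, then \<open>F(t + y)\<^bsup>m\<^esup>\<close> is congruent to \<open>(y h)\<^bsup>m\<^esup>\<close> modulo \<open>F\<close>, because \<open>a - b\<close> divides
  \<open>a\<^bsup>m\<^esup> - b\<^bsup>m\<^esup>\<close>.
\<close>

lemma taylor_poly_power_dvd:
  assumes "taylor_poly F = pCons F h"
  shows "[:F:] dvd taylor_poly (F ^ m) - Polynomial.monom 1 m * h ^ m"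
proof -
  let ?y = "[:0, 1:] * h"
  have "[:F:] = taylor_poly F - ?y" using assms by simp
  then have "[:F:] dvd taylor_poly F ^ m - ?y ^ m" by (simp add: power_diff_sumr2)
  then show ?thesis
    by (simp add: taylor_poly_power power_mult_distrib monom_altdef del: mult_pCons_left)
qed

text \<open>
  The vector corresponds to \<open>F(t + y)\<^bsup>r\<^esup>\<close>, which is congruent to \<open>y\<^bsup>r\<^esup> h\<^bsup>r\<^esup>\<close> modulo \<open>F\<close> and so lies in the ideal.
\<close>

lemma jordan_companion_mat_annihilated:
  fixes F :: "'a::comm_ring_1 poly"
  assumes F: "monic F" and d: "d = Polynomial.degree F" "d > 0" and r: "r > 0"
  shows "poly_mat_eval (F ^ r) (jordan_companion_mat F r) *\<^sub>v unit_vec (r * d) 0 = 0\<^sub>v (r * d)"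
proof (rule bivariate_in_ideal_imp_0[OF F d])
  have J: "jordan_companion_mat F r \<in> carrier_mat (r * d) (r * d)"
    using d by (simp add: jordan_companion_mat_carrier)
  let ?u = "poly_mat_eval (F ^ r) (jordan_companion_mat F r) *\<^sub>v unit_vec (r * d) 0"
  show "?u \<in> carrier_vec (r * d)" using J by simp
  obtain h where h: "taylor_poly F = pCons F h"
    by (rule taylor_poly_pConsE)
  have "bivariate d r ?u = (bivariate d r ?u - taylor_poly (F ^ r)) +
      ((taylor_poly (F ^ r) - Polynomial.monom 1 r * h ^ r) + Polynomial.monom 1 r * h ^ r)"
    by simp
  also have "in_ideal F r \<dots>"
  proof (intro in_ideal_add)
    show "in_ideal F r (bivariate d r ?u - taylor_poly (F ^ r))"
      using bivariate_poly_mat_eval[OF F d, of "unit_vec (r * d) 0" r "F ^ r"]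
        bivariate_unit_vec[OF d(2) r, where ?'a = 'a] by simp
    show "in_ideal F r (taylor_poly (F ^ r) - Polynomial.monom 1 r * h ^ r)"
      by (rule in_ideal_const_dvd[OF taylor_poly_power_dvd[OF h]])
    show "in_ideal F r (Polynomial.monom 1 r * h ^ r)"
      by (simp add: in_ideal_def coeff_monom_mult)
  qed
  finally show "in_ideal F r (bivariate d r ?u)" .
qed

text \<open>
  Otherwise \<open>f(t + y)\<^bsup>r\<^esup>\<close> would lie in the ideal \<open>(f, y\<^bsup>r+1\<^esup>)\<close>. Its coefficient of \<open>y\<^bsup>r\<^esup>\<close> is \<open>f'\<^bsup>r\<^esup>\<close> modulo \<open>f\<close>, so the
  prime \<open>f\<close> would divide \<open>f'\<close>, which is nonzero of smaller degree.
\<close>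

lemma jordan_companion_mat_not_annihilated:
  fixes f :: "'k::field poly"
  assumes f: "monic f" "Factorial_Ring.irreducible f" "pderiv f \<noteq> 0" and d: "d = Polynomial.degree f" "d > 0"
  shows "poly_mat_eval (f ^ r) (jordan_companion_mat f (Suc r)) *\<^sub>v unit_vec (Suc r * d) 0 \<noteq> 0\<^sub>v (Suc r * d)"
proof
  let ?u = "poly_mat_eval (f ^ r) (jordan_companion_mat f (Suc r)) *\<^sub>v unit_vec (Suc r * d) 0"
  assume "?u = 0\<^sub>v (Suc r * d)"
  moreover have "bivariate d (Suc r) (0\<^sub>v (Suc r * d)) = (0 :: 'k poly poly)"
    using block_index_less[of _ "Suc r" _ d] by (intro poly_eqI) (auto simp: coeff_bivariate coeff_block_poly)
  ultimately have "in_ideal f (Suc r) (- taylor_poly (f ^ r))"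
    using bivariate_poly_mat_eval[OF f(1) d, of "unit_vec (Suc r * d) 0" "Suc r" "f ^ r"]
        bivariate_unit_vec[OF d(2), of "Suc r", where ?'a = 'k] by simp
  then have T: "in_ideal f (Suc r) (taylor_poly (f ^ r))" using in_ideal_minus by fastforce
  obtain h where h: "taylor_poly f = pCons f h"
    by (rule taylor_poly_pConsE)
  have h0: "Polynomial.coeff h 0 = pderiv f"
    using coeff_1_taylor_poly[of f] by (simp add: h)
  have "in_ideal f (Suc r) (taylor_poly (f ^ r) + - (taylor_poly (f ^ r) - Polynomial.monom 1 r * h ^ r))"
    by (intro in_ideal_add in_ideal_minus T in_ideal_const_dvd taylor_poly_power_dvd h)
  then have "f dvd Polynomial.coeff (Polynomial.monom 1 r * h ^ r) r"
    by (simp add: in_ideal_def)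
  also have "Polynomial.coeff (Polynomial.monom 1 r * h ^ r) r = pderiv f ^ r"
    by (simp add: coeff_monom_mult h0 coeff_0_power)
  finally have "f dvd pderiv f"
    using field_poly_irreducible_imp_prime[OF f(2)] prime_elem_dvd_power by blast
  then have "Polynomial.degree f \<le> Polynomial.degree (pderiv f)" using f(3) by (rule dvd_imp_degree_le)
  moreover have "Polynomial.degree (pderiv f) \<le> d - 1" 
    by (rule degree_le) (auto simp: coeff_pderiv coeff_eq_0 d(1))
  ultimately show False using d by simp
qed

section \<open>Reduction to the residue field and conclusion\<close>

lemma monic_map_poly:
  assumes "comm_ring_hom \<rho>" "monic F"
  shows "monic (map_poly \<rho> F)" "Polynomial.degree (map_poly \<rho> F) = Polynomial.degree F"
proof -
  interpret comm_ring_hom \<rho> by fact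
  show deg: "Polynomial.degree (map_poly \<rho> F) = Polynomial.degree F"
    using assms(2) by (intro antisym degree_map_poly_le le_degree) simp
  then show "monic (map_poly \<rho> F)" using assms(2) by simp
qed

lemma map_mat_jordan_companion_mat:
  fixes F :: "'a::comm_ring_1 poly"
  assumes "comm_ring_hom \<rho>" "monic F"
  shows "map_mat \<rho> (jordan_companion_mat F r) = jordan_companion_mat (map_poly \<rho> F) r"
proof -
  interpret comm_ring_hom \<rho> by fact
  note deg = monic_map_poly(2)[OF assms]
  have "map_mat \<rho> (companion_mat F) = companion_mat (map_poly \<rho> F)"
    by (intro eq_matI) (auto simp: companion_mat_def Let_def deg hom_distribs)
  then have c: "\<rho> (companion_mat F $$ (i, j)) = companion_mat (map_poly \<rho> F) $$ (i, j)"
    if "i < Polynomial.degree F" "j < Polynomial.degree F" for i j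
    using that companion_mat_carrier[of F] by (metis carrier_matD index_map_mat(1))
  have "d > 0" if "i < r * d" for i d :: nat using that by (cases d) auto
  then show "map_mat \<rho> (jordan_companion_mat F r) = jordan_companion_mat (map_poly \<rho> F) r"
    by (intro eq_matI) (auto simp: jordan_companion_mat_def Let_def deg c hom_distribs)
qed

lemma map_mat_krylov:
  assumes "comm_ring_hom \<rho>" "A \<in> carrier_mat n n" "v \<in> carrier_vec n"
  shows "map_mat \<rho> (krylov_mat A v) = krylov_mat (map_mat \<rho> A) (map_vec \<rho> v)"
proof -
  interpret comm_ring_hom \<rho> by fact
  have "\<rho> ((A ^\<^sub>m j *\<^sub>v v) $ i) = (map_mat \<rho> A ^\<^sub>m j *\<^sub>v map_vec \<rho> v) $ i" if "i < n" for i j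
  proof -
    have "map_vec \<rho> (A ^\<^sub>m j *\<^sub>v v) = map_mat \<rho> A ^\<^sub>m j *\<^sub>v map_vec \<rho> v"
      using assms(2,3) by (simp add: mult_mat_vec_hom[of _ n n] mat_hom_pow)
    then show ?thesis using pow_mat_vec_carrier[OF assms(2,3), of j] that
      by (metis carrier_vecD index_map_vec(1))
  qed
  then show ?thesis using assms(2) by (intro eq_matI) (auto simp: krylov_mat_def)
qed

theorem proposition5p5:
  fixes M :: "'a::comm_ring_1 set"
    and \<rho> :: "'a \<Rightarrow> 'k::field"
    and F :: "'a poly"
    and A :: "'a mat"
    and n r :: nat
  assumes "finite (UNIV :: 'a set)"
    and "local_pir_of_length_two (ring_of_type_algebra :: 'a ring)"
    and "maximalideal M (ring_of_type_algebra :: 'a ring)"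
    and "residue_map M \<rho>"
    and "odd CHAR('k)"
    and "monic F" and "fundamental_irreducible \<rho> F"
    and "r \<ge> 1"
    and "A \<in> GL n"
    and "compatible_cyclic \<rho> A"
    and "char_poly A = F ^ r"
    and "map_mat \<rho> A \<in> GL n"
    and "cyclic_mat \<rho> A"
    and "char_poly (map_mat \<rho> A) = map_poly \<rho> F ^ r"
  shows "similar_mat A (jordan_companion_mat F r)"
proof -
  have \<rho>: "comm_ring_hom \<rho>" "surj \<rho>" "{a. \<rho> a = 0} = M"
    using assms(4) by (auto simp: residue_map_def)
  interpret comm_ring_hom \<rho> by (rule \<rho>(1))
  have fin: "finite (UNIV :: 'k set)" using assms(1) \<rho>(2) by (metis finite_imageI)
  have unit: "\<exists>u. a * u = 1" if "\<rho> a \<noteq> 0" for a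
  proof -
    have "a \<notin> M" using that \<rho>(3) by auto
    then show ?thesis
      using unit_outside_maximalideal[OF assms(1) _ assms(3)] assms(2)
      unfolding local_pir_of_length_two_def by metis
  qed
  define f where "f = map_poly \<rho> F"
  define d where "d = Polynomial.degree F"
  have f: "monic f" "Polynomial.degree f = d" "Factorial_Ring.irreducible f"
    using monic_map_poly[OF \<rho>(1) assms(6)] assms(7)
    by (auto simp: f_def d_def fundamental_irreducible_def)
  have "d > 0"
  proof (rule ccontr)
    assume "\<not> d > 0"
    then have "f = 1" using f(1,2) monic_degree_0 by blast
    with f(3) show False by (simp add: Factorial_Ring.irreducible_def)
  qed
  obtain s where r: "r = Suc s" using assms(8) by (cases r) auto
  have A: "A \<in> carrier_mat n n" using assms(9) by (simp add: GL_def)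
  have degf: "Polynomial.degree (f ^ m) = m * d" for m using f(1,2) by (subst degree_power_eq) auto
  have n: "n = r * d"
    using degree_monic_char_poly[of "map_mat \<rho> A" n] A assms(14) degf by (simp add: f_def)
  have degF: "Polynomial.degree (F ^ r) = n" and Ft: "monic (F ^ r)"
    using degree_monic_char_poly[OF A] unfolding assms(11) by metis+
  have krylov_unit: "\<exists>u. det (krylov_mat B v) * u = 1"
    if B: "B \<in> carrier_mat n n" and v: "v \<in> carrier_vec n"
      and v1: "poly_mat_eval (f ^ s) (map_mat \<rho> B) *\<^sub>v map_vec \<rho> v \<noteq> 0\<^sub>v n"
      and v2: "poly_mat_eval (f ^ r) (map_mat \<rho> B) *\<^sub>v map_vec \<rho> v = 0\<^sub>v n" for B v
  proof -
    have "det (krylov_mat (map_mat \<rho> B) (map_vec \<rho> v)) \<noteq> 0"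
      by (rule krylov_det_nonzero[of _ n _ f s]) (use B v v1 v2 f(3) n degf[of r] r in auto)
    then have "\<rho> (det (krylov_mat B v)) \<noteq> 0"
      by (simp add: map_mat_krylov[OF \<rho>(1) B v] flip: hom_det)
    then show ?thesis by (rule unit)
  qed
  have simA: "similar_mat A (companion_mat (F ^ r))"
  proof -
    let ?B = "map_mat \<rho> A"
    have B: "?B \<in> carrier_mat n n" using A by simp
    have min: "poly_mat_eval (f ^ r) ?B = 0\<^sub>m n n"
      "\<And>q. poly_mat_eval q ?B = 0\<^sub>m n n \<Longrightarrow> f ^ r dvd q"
      using assms(13,14) B unfolding cyclic_mat_def is_minimal_polynomial_def f_def by auto
    have "f ^ s \<noteq> 0" using f(1) by auto
    have "\<not> f ^ r dvd f ^ s"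
    proof
      assume "f ^ r dvd f ^ s"
      then have "r * d \<le> s * d" using dvd_imp_degree_le[of "f ^ r" "f ^ s"] \<open>f ^ s \<noteq> 0\<close>
        unfolding degf by blast
      with r \<open>d > 0\<close> show False by simp
    qed
    with min(2) have "poly_mat_eval (f ^ s) ?B \<noteq> 0\<^sub>m n n" by blast
    \<comment> \<open>A nonzero column of \<open>f\<^bsup>s\<^esup>\<close> at the reduction of \<open>A\<close>; its unit vector lifts to the ring.\<close>
    then obtain i j where ij: "i < n" "j < n" "poly_mat_eval (f ^ s) ?B $$ (i, j) \<noteq> 0"
      using poly_mat_eval_carrier[OF B, of "f ^ s"]
      by (metis carrier_matD eq_matI index_zero_mat)
    let ?v = "unit_vec n j"
    have hv: "map_vec \<rho> ?v = unit_vec n j" by (intro eq_vecI) (auto simp: unit_vec_def)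
    have "poly_mat_eval (f ^ s) ?B *\<^sub>v unit_vec n j = col (poly_mat_eval (f ^ s) ?B) j"
      using poly_mat_eval_carrier[OF B, of "f ^ s"] ij(2) by (intro eq_vecI) auto
    moreover have "col (poly_mat_eval (f ^ s) ?B) j $ i \<noteq> 0"
      using ij A by simp
    ultimately have "poly_mat_eval (f ^ s) ?B *\<^sub>v map_vec \<rho> ?v \<noteq> 0\<^sub>v n"
      using ij(1) unfolding hv by auto
    moreover have "poly_mat_eval (f ^ r) ?B *\<^sub>v map_vec \<rho> ?v = 0\<^sub>v n"
      unfolding min(1) by (intro eq_vecI) auto
    ultimately obtain u where "det (krylov_mat A ?v) * u = 1"
      using krylov_unit[OF A, of ?v] by auto
    then have "similar_mat A (companion_mat (char_poly A))"
      by (rule similar_companion_char_poly[OF A unit_vec_carrier])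
    then show ?thesis using assms(11) by simp
  qed
  have simJ: "similar_mat (jordan_companion_mat F r) (companion_mat (F ^ r))"
  proof -
    let ?J = "jordan_companion_mat F r" and ?v = "unit_vec n 0"
    have J: "?J \<in> carrier_mat n n" using jordan_companion_mat_carrier[of F d r] n d_def by simp
    have hJ: "map_mat \<rho> ?J = jordan_companion_mat f r"
      unfolding f_def by (rule map_mat_jordan_companion_mat[OF \<rho>(1) assms(6)])
    have hv: "map_vec \<rho> ?v = unit_vec n 0" by (intro eq_vecI) (auto simp: unit_vec_def)
    have v: "?v \<in> carrier_vec n" by simp
    have "poly_mat_eval (f ^ s) (map_mat \<rho> ?J) *\<^sub>v map_vec \<rho> ?v \<noteq> 0\<^sub>v n"
      unfolding hJ hv unfolding n r
      by (rule jordan_companion_mat_not_annihilated[OF f(1,3) pderiv_irreducible_nonzero[OF fin f(3)] f(2)[symmetric] \<open>d > 0\<close>])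
    moreover have "poly_mat_eval (f ^ r) (map_mat \<rho> ?J) *\<^sub>v map_vec \<rho> ?v = 0\<^sub>v n"
      unfolding hJ hv unfolding n using r
      by (intro jordan_companion_mat_annihilated[OF f(1) f(2)[symmetric] \<open>d > 0\<close>]) simp
    ultimately obtain u where "det (krylov_mat ?J ?v) * u = 1"
      using krylov_unit[OF J v] by blast
    moreover have "poly_mat_eval (F ^ r) ?J *\<^sub>v ?v = 0\<^sub>v n"
      unfolding n using r
      by (intro jordan_companion_mat_annihilated[OF assms(6) d_def \<open>d > 0\<close>]) simp
    ultimately show ?thesis using similar_companion_mat[OF J v _ degF] Ft degF by blast
  qed
  show ?thesis using simA similar_mat_sym[OF simJ] by (rule similar_mat_trans)
qed

end
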